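(* Let $k\ge 0$ be an integer. The largest size of a $(2k+1,2k+3)$-core partition into distinct parts is $\dfrac{k(k+1)(k+2)(5k+11)}{24}$.
   Context: A partition is a weakly decreasing finite sequence of positive integers (the empty partition allowed); its size is the sum of its parts. The hook length of a box in the Young diagram is the number of boxes to its right in its row, below it in its column, plus one. A partition is a $t$-core if no box has hook length divisible by $t$; an $(s,t)$-core is simultaneously an $s$-core and a $t$-core. A partition into distinct parts has pairwise distinct parts. *)

theory Defs
  imports Complex_Main
begin

definition is_partition :: "nat list \<Rightarrow> bool" where
  "is_partition p \<longleftrightarrow> sorted_wrt (\<ge>) p \<and> (\<forall>x\<in>set p. 0 < x)"

abbreviation partition_size :: "nat list \<Rightarrow> nat" where
  "partition_size p \<equiv> sum_list p"

(* Boxes are pairs (row, column), both counted from 0; row i has p ! i boxes. *)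
definition young_diagram :: "nat list \<Rightarrow> (nat \<times> nat) set" where
  "young_diagram p = {(i, j). i < length p \<and> j < p ! i}"

definition hook_length :: "nat list \<Rightarrow> nat \<times> nat \<Rightarrow> nat" where
  "hook_length p = (\<lambda>(i, j).
     card {j'. j < j' \<and> (i, j') \<in> young_diagram p}
     + card {i'. i < i' \<and> (i', j) \<in> young_diagram p} + 1)"

definition is_core :: "nat \<Rightarrow> nat list \<Rightarrow> bool" where
  "is_core t p \<longleftrightarrow> (\<forall>b\<in>young_diagram p. \<not> t dvd hook_length p b)"

definition distinct_core_partitions :: "nat \<Rightarrow> nat \<Rightarrow> nat list set" where
  "distinct_core_partitions s t =
     {p. is_partition p \<and> distinct p \<and> is_core s p \<and> is_core t p}"

end

theory Submission
  imports Defs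
begin

text \<open>
  Encode a partition by its set \<open>X\<close> of first-column hook lengths. It is a \<open>t\<close>-core iff
  \<open>X\<close> is closed under subtracting \<open>t\<close>, and its parts are distinct iff \<open>X\<close> contains
  no two consecutive numbers. Put \<open>s = 2k + 1\<close> and let \<open>n r\<close> be the number of elements
  of \<open>X\<close> in the residue class \<open>r\<close> modulo \<open>s\<close>. Closure under \<open>s + 2\<close> says that along the
  residues \<open>0, 2, \<dots>, 2k, 1, 3, \<dots>, 2k - 1\<close> the heights \<open>n\<close> rise by at most 1 per step,
  and by at most 2 from \<open>2k\<close> to \<open>1\<close>. At most one of the residues \<open>2j + 1\<close> and
  \<open>2j + 2\<close> is occupied; let \<open>h j\<close> be its height. Then four times the size is
  \[ 2(k+1) \sum_j h_j^2 + 4 \sum_j n_{2j+2} +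
     \sum_{i,j} \bigl((h_j - h_i)^2 + 2\,\mathrm{sgn}(j - i)(h_j - h_i)\bigr). \]
  Let \<open>\<rho>\<close> rank the indices by height. Descending along the residues from a given height
  visits all smaller positive heights, except possibly one skipped at the step from \<open>1\<close>
  to \<open>2k\<close>. Hence each term above is bounded by its value at \<open>h j = \<rho> j + 2\<close> with all even
  residues empty and \<open>|\<rho> j - \<rho> i|\<close> in place of the signed difference. Summing over the
  permutation \<open>\<rho>\<close> gives the bound, attained by \<open>n (2j + 1) = j + 2\<close>.
\<close>

section \<open>Partitions and their first-column hook lengths\<close>

text \<open>In a partition, the first box of the row \<open>a\<close> has arm \<open>a - 1\<close>
  and leg \<open>length p\<close>, hence hook length \<open>a + length p\<close>.\<close>

fun beta_set :: "nat list \<Rightarrow> nat set" where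
  "beta_set [] = {}"
| "beta_set (a # p) = insert (a + length p) (beta_set p)"

lemma is_partition_Nil: "is_partition []"
  by (simp add: is_partition_def)

lemma is_partition_Cons:
  "is_partition (a # p) \<longleftrightarrow> 0 < a \<and> (\<forall>x\<in>set p. x \<le> a) \<and> is_partition p"
  by (auto simp: is_partition_def)

lemma beta_set_conv_nth:
  "beta_set p = (\<lambda>i. p ! i + (length p - 1 - i)) ` {..<length p}"
proof (induction p)
  case (Cons a p)
  then show ?case
    by (simp add: lessThan_Suc_eq_insert_0 image_image)
qed simp

lemma finite_beta_set [simp]: "finite (beta_set p)"
  by (induction p) auto

lemma beta_set_less:
  assumes "is_partition (a # p)" "x \<in> beta_set p"
  shows "x < a + length p"
  using assms
proof (induction p arbitrary: a)
  case (Cons b q)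
  then have "b \<le> a" "is_partition (b # q)"
    by (auto simp: is_partition_Cons)
  then show ?case
    using Cons.IH[of b] Cons.prems(2) by force
qed simp

lemma zero_notin_beta_set: "is_partition p \<Longrightarrow> 0 \<notin> beta_set p"
  by (induction p) (auto simp: is_partition_Cons)

lemma card_beta_set: "is_partition p \<Longrightarrow> card (beta_set p) = length p"
proof (induction p)
  case (Cons a p)
  have "a + length p \<notin> beta_set p"
    using beta_set_less[OF Cons.prems] by blast
  with Cons show ?case by (simp add: is_partition_Cons)
qed simp

lemma sum_beta_set:
  "is_partition p \<Longrightarrow>
     real (\<Sum>(beta_set p)) = real (partition_size p) + real (length p) * (real (length p) - 1) / 2"
proof (induction p)
  case (Cons a p)
  have "a + length p \<notin> beta_set p"
    using beta_set_less[OF Cons.prems] by blast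
  with Cons show ?case by (simp add: is_partition_Cons field_simps)
qed simp

lemma partition_size_eq:
  assumes "is_partition p"
  shows "real (partition_size p) =
    real (\<Sum>(beta_set p)) - real (card (beta_set p)) * (real (card (beta_set p)) - 1) / 2"
  using sum_beta_set[OF assms] card_beta_set[OF assms] by simp

text \<open>Neighbouring elements of the beta set differ by the difference of their parts plus one,
  so distinct parts keep them at least 2 apart.\<close>

lemma no_consecutive_beta_set:
  assumes "is_partition p" "distinct p" "x \<in> beta_set p"
  shows "Suc x \<notin> beta_set p"
  using assms
proof (induction p)
  case (Cons a p)
  have *: "y < a + length p" if "y \<in> beta_set p" for y
    using beta_set_less[OF Cons.prems(1) that] .
  have "Suc y \<noteq> a + length p" if y: "y \<in> beta_set p" for y
  proof (cases p)
    case Nil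
    with y show ?thesis by simp
  next
    case p: (Cons b q)
    have bq: "is_partition (b # q)" "b \<le> a" "b \<noteq> a"
      using Cons.prems(1,2) unfolding p is_partition_Cons[of a] by simp_all
    have "y \<le> b + length q"
      using y beta_set_less[OF bq(1), of y] by (auto simp: p)
    then show ?thesis using bq p by simp
  qed
  moreover have "is_partition p" "distinct p"
    using Cons.prems by (auto simp: is_partition_Cons)
  moreover have "Suc (a + length p) \<notin> beta_set p"
    using *[of "Suc (a + length p)"] by auto
  ultimately show ?case
    using Cons.IH Cons.prems(3) by auto
qed simp

text \<open>The partition is built from its smallest part: each new maximum \<open>b\<close> of the
  set becomes a new first part \<open>b - length p\<close>.\<close>

lemma ex_partition_beta_set:
  assumes "finite Y" "0 \<notin> Y" "\<And>x. x \<in> Y \<Longrightarrow> Suc x \<notin> Y"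
  shows "\<exists>p. is_partition p \<and> distinct p \<and> beta_set p = Y"
  using assms
proof (induction rule: finite_linorder_max_induct)
  case empty
  show ?case by (rule exI[of _ "[]"]) (simp add: is_partition_Nil)
next
  case (insert b A)
  then obtain p where p: "is_partition p" "distinct p" "beta_set p = A"
    by auto
  have "\<forall>x\<in>set p. x + length p < b"
  proof (cases p)
    case (Cons c q)
    have c: "c + length q \<in> A" using p Cons by auto
    then have "c + length q < b" "Suc (c + length q) \<noteq> b"
      using insert.hyps(2) insert.prems(2)[of "c + length q"] by auto
    moreover have "\<forall>x\<in>set p. x \<le> c" using p Cons by (auto simp: is_partition_Cons)
    ultimately show ?thesis using Cons by fastforce
  qed simp
  \<comment> \<open>This makes the new part positive; for empty \<open>p\<close> it is the
    hypothesis that 0 is not in the set.\<close>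
  moreover have "length p < b"
    using calculation insert.prems(1) p(1) by (cases p) auto
  ultimately have "is_partition ((b - length p) # p) \<and> distinct ((b - length p) # p) \<and>
      beta_set ((b - length p) # p) = insert b A"
    using p by (fastforce simp: is_partition_Cons)
  then show ?case by blast
qed

section \<open>Hook lengths and the core condition on beta sets\<close>

lemma nth_partition_mono:
  assumes "is_partition p" "i \<le> j" "j < length p"
  shows "p ! j \<le> p ! i"
  using assms by (cases "i = j") (auto simp: is_partition_def sorted_wrt_iff_nth_less)

text \<open>Row \<open>m\<close> is the last one reaching column \<open>j\<close>, so the leg is
  \<open>m - i\<close> and the arm \<open>p ! i - j - 1\<close>.\<close>

lemma hook_length_eq:
  assumes p: "is_partition p" and m: "i \<le> m" "m < length p" "j < p ! m"
    and above: "\<And>i'. m < i' \<Longrightarrow> i' < length p \<Longrightarrow> p ! i' \<le> j"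
  shows "(i, j) \<in> young_diagram p" "hook_length p (i, j) = p ! i - j + (m - i)"
proof -
  have i: "j < p ! i" using nth_partition_mono[OF p m(1,2)] m by simp
  show "(i, j) \<in> young_diagram p" using i m by (simp add: young_diagram_def)
  have "{j'. j < j' \<and> (i, j') \<in> young_diagram p} = {j<..<p ! i}"
    using m by (auto simp: young_diagram_def)
  moreover have "{i'. i < i' \<and> (i', j) \<in> young_diagram p} = {i<..m}"
  proof (intro set_eqI)
    fix i'
    have "j < p ! i'" if "i' \<le> m" using nth_partition_mono[OF p that m(2)] m by simp
    then show "i' \<in> {i'. i < i' \<and> (i', j) \<in> young_diagram p} \<longleftrightarrow> i' \<in> {i<..m}"
      using m above[of i'] by (fastforce simp: young_diagram_def not_le[symmetric])
  qed
  ultimately show "hook_length p (i, j) = p ! i - j + (m - i)"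
    using i by (simp add: hook_length_def)
qed

lemma ex_last_index:
  fixes P :: "nat \<Rightarrow> bool"
  assumes "P i" "i < n"
  shows "\<exists>m. i \<le> m \<and> m < n \<and> P m \<and> (\<forall>i'. m < i' \<and> i' < n \<longrightarrow> \<not> P i')"
proof -
  let ?S = "{i'. i \<le> i' \<and> i' < n \<and> P i'}"
  have S: "finite ?S" "?S \<noteq> {}" using assms by auto
  have "Max ?S \<in> ?S" using Max_in[OF S] .
  moreover have "\<not> P i'" if "Max ?S < i'" "i' < n" for i'
  proof
    assume "P i'"
    then have "i' \<in> ?S" using that calculation by auto
    then show False using Max_ge[OF S(1)] that by fastforce
  qed
  ultimately show ?thesis by blast
qed

text \<open>The hook lengths in row \<open>i\<close> are the differences between its beta number and
  the smaller gaps. Column \<open>j\<close> corresponds to the gap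
  \<open>j + (length p - 1 - m)\<close>, where \<open>m\<close> is the last row reaching that
  column.\<close>

lemma is_core_iff_gap:
  assumes p: "is_partition p"
  shows "is_core t p \<longleftrightarrow>
    (\<forall>x\<in>beta_set p. \<forall>y<x. y \<notin> beta_set p \<longrightarrow> \<not> t dvd (x - y))"
proof -
  let ?n = "length p"
  define b where "b i = p ! i + (?n - 1 - i)" for i
  have beta: "beta_set p = b ` {..<?n}"
    by (simp add: beta_set_conv_nth b_def[abs_def])
  show ?thesis
  proof (intro iffI ballI allI impI)
    fix x y assume core: "is_core t p" and "x \<in> beta_set p" and y: "y < x" "y \<notin> beta_set p"
    then obtain i where i: "i < ?n" "x = b i" by (auto simp: beta)
    then obtain m where m: "i \<le> m" "m < ?n" "y < b m" "\<And>i'. m < i' \<Longrightarrow> i' < ?n \<Longrightarrow> \<not> y < b i'"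
      using ex_last_index[of "\<lambda>i. y < b i" i ?n] y by blast
    have less: "b i' < y" if "m < i'" "i' < ?n" for i'
      using m(4)[OF that] y that by (force simp: beta)
    \<comment> \<open>This keeps the subtraction defining \<open>j\<close> from truncating.\<close>
    have ge: "?n - 1 - m \<le> y"
    proof (cases "Suc m < ?n")
      case True
      show ?thesis using less[of "Suc m"] True by (simp add: b_def)
    qed auto
    define j where "j = y - (?n - 1 - m)"
    have yj: "y = j + (?n - 1 - m)" using ge by (simp add: j_def)
    have jm: "j < p ! m" using m(3) by (simp add: yj b_def)
    have "p ! i' \<le> j" if "m < i'" "i' < ?n" for i'
    proof -
      have "p ! i' \<le> p ! Suc m" using nth_partition_mono[OF p, of "Suc m" i'] that by simp
      moreover have "b (Suc m) < y" using less[of "Suc m"] that by simp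
      ultimately show ?thesis using that by (simp add: yj b_def)
    qed
    note h = hook_length_eq[OF p m(1,2) jm this]
    have "p ! m \<le> p ! i" using nth_partition_mono[OF p m(1,2)] .
    then have "p ! i - j + (m - i) = x - y"
      using jm m i by (simp add: yj b_def)
    then show "\<not> t dvd (x - y)"
      using core h unfolding is_core_def by force
  next
    assume gap: "\<forall>x\<in>beta_set p. \<forall>y<x. y \<notin> beta_set p \<longrightarrow> \<not> t dvd (x - y)"
    show "is_core t p" unfolding is_core_def
    proof
      fix c assume c: "c \<in> young_diagram p"
      obtain i j where ij: "c = (i, j)" "i < ?n" "j < p ! i"
        using c by (cases c) (auto simp: young_diagram_def)
      then obtain m where m: "i \<le> m" "m < ?n" "j < p ! m"
        "\<And>i'. m < i' \<Longrightarrow> i' < ?n \<Longrightarrow> \<not> j < p ! i'"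
        using ex_last_index[of "\<lambda>i. j < p ! i" i ?n] by blast
      have hook: "hook_length p (i, j) = p ! i - j + (m - i)"
        using hook_length_eq(2)[OF p m(1,2,3)] m(4) by (simp add: not_less)
      define y where "y = j + (?n - 1 - m)"
      have "y \<noteq> b i'" if "i' < ?n" for i'
      proof (cases "i' \<le> m")
        case True
        then have "j < p ! i'" using nth_partition_mono[OF p True m(2)] m(3) by simp
        then show ?thesis using True m(2) by (simp add: y_def b_def)
      next
        case False
        then show ?thesis using m(4)[of i'] that by (simp add: y_def b_def)
      qed
      then have "y \<notin> beta_set p" by (auto simp: beta)
      moreover have "y < b i" "b i - y = hook_length p (i, j)"
        using ij m hook by (auto simp: y_def b_def)
      moreover have "b i \<in> beta_set p" using ij by (auto simp: beta)
      ultimately show "\<not> t dvd hook_length p c" using gap ij(1) by metis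
    qed
  qed
qed

text \<open>If \<open>t\<close> divides the distance from an element \<open>x\<close> down to a gap
  \<open>y\<close>, repeated subtraction of \<open>t\<close> from \<open>x\<close> would reach
  \<open>y\<close>.\<close>

lemma is_core_iff_closed:
  assumes p: "is_partition p" and t: "0 < t"
  shows "is_core t p \<longleftrightarrow> (\<forall>x\<in>beta_set p. t \<le> x \<longrightarrow> x - t \<in> beta_set p)"
proof
  assume "is_core t p"
  then have gap: "\<forall>x\<in>beta_set p. \<forall>y<x. y \<notin> beta_set p \<longrightarrow> \<not> t dvd (x - y)"
    by (simp add: is_core_iff_gap[OF p])
  show "\<forall>x\<in>beta_set p. t \<le> x \<longrightarrow> x - t \<in> beta_set p"
  proof (intro ballI impI, rule ccontr)
    fix x assume "x \<in> beta_set p" "t \<le> x" "x - t \<notin> beta_set p"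
    moreover have "x - t < x" using t \<open>t \<le> x\<close> by simp
    ultimately have "\<not> t dvd (x - (x - t))" using gap by blast
    then show False using \<open>t \<le> x\<close> by simp
  qed
next
  assume closed: "\<forall>x\<in>beta_set p. t \<le> x \<longrightarrow> x - t \<in> beta_set p"
  have "x - t * m \<in> beta_set p" if "x \<in> beta_set p" "t * m \<le> x" for x m
    using that
  proof (induction m)
    case (Suc m)
    then have "x - t * m \<in> beta_set p" "t \<le> x - t * m" by auto
    then have "x - t * m - t \<in> beta_set p" using closed by blast
    then show ?case by (simp add: algebra_simps)
  qed simp
  note iterate = this
  show "is_core t p"
    unfolding is_core_iff_gap[OF p]
  proof (intro ballI allI impI notI)
    fix x y assume x: "x \<in> beta_set p" and y: "y < x" "y \<notin> beta_set p" and "t dvd x - y"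
    then obtain m where "x - y = t * m" by (auto elim: dvdE)
    then have "y = x - t * m" "t * m \<le> x" using y(1) by auto
    then show False using iterate[OF x] y(2) by blast
  qed
qed


section \<open>Sets closed under subtracting \<open>s\<close>, as abacus configurations\<close>

text \<open>An abacus with \<open>s\<close> runners, where runner \<open>r\<close> has its lowest
  \<open>n r\<close> positions filled.\<close>

definition bead_set :: "nat \<Rightarrow> (nat \<Rightarrow> nat) \<Rightarrow> nat set" where
  "bead_set s n = {x. x div s < n (x mod s)}"

lemma bead_set_conv_image:
  assumes "0 < s"
  shows "bead_set s n = (\<lambda>(r, m). r + m * s) ` (SIGMA r:{..<s}. {..<n r})"
proof (intro equalityI subsetI)
  fix x assume "x \<in> bead_set s n"
  then have "(x mod s, x div s) \<in> (SIGMA r:{..<s}. {..<n r})" "x = x mod s + x div s * s"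
    using assms by (auto simp: bead_set_def)
  then show "x \<in> (\<lambda>(r, m). r + m * s) ` (SIGMA r:{..<s}. {..<n r})" by force
qed (use assms in \<open>auto simp: bead_set_def\<close>)

lemma inj_on_bead:
  "inj_on (\<lambda>(r, m). r + m * s) (SIGMA r:{..<s::nat}. {..<n r})"
proof (rule inj_onI)
  fix x y assume *: "x \<in> (SIGMA r:{..<s}. {..<n r})" "y \<in> (SIGMA r:{..<s}. {..<n r})"
    and eq: "(\<lambda>(r, m). r + m * s) x = (\<lambda>(r, m). r + m * s) y"
  obtain r m r' m' where xy: "x = (r, m)" "y = (r', m')" by (cases x, cases y)
  have rs: "r < s" "r' < s" "r + m * s = r' + m' * s" using * eq xy by auto
  then have "r = r'" by (metis mod_less mod_mult_self1)
  then show "x = y" using rs xy by auto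
qed

lemma finite_bead_set: "0 < s \<Longrightarrow> finite (bead_set s n)"
  by (simp add: bead_set_conv_image)

lemma card_bead_set:
  assumes "0 < s" shows "card (bead_set s n) = (\<Sum>r<s. n r)"
  by (simp add: bead_set_conv_image[OF assms] card_image[OF inj_on_bead])

lemma sum_bead_set:
  assumes "0 < s"
  shows "real (\<Sum>(bead_set s n)) = (\<Sum>r<s. real r * n r + real s * (real (n r) * (real (n r) - 1) / 2))"
proof -
  have aux: "(\<Sum>m<N. real (r + m * s)) = real r * N + real s * (real N * (real N - 1) / 2)" for r N
    by (induction N) (auto simp: field_simps)
  have "real (\<Sum>(bead_set s n)) = (\<Sum>(r, m)\<in>(SIGMA r:{..<s}. {..<n r}). real (r + m * s))"
    by (simp only: bead_set_conv_image[OF assms] of_nat_sum sum.reindex[OF inj_on_bead])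
       (simp only: case_prod_unfold o_def)
  also have "\<dots> = (\<Sum>r<s. \<Sum>m<n r. real (r + m * s))"
    by (subst sum.Sigma) auto
  finally show ?thesis by (simp only: aux)
qed

lemma closed_eq_bead_set:
  assumes fin: "finite X" and s: "0 < s" and closed: "\<And>x. x \<in> X \<Longrightarrow> s \<le> x \<Longrightarrow> x - s \<in> X"
  shows "\<exists>n. X = bead_set s n"
proof -
  define n where "n r = (LEAST m. r + m * s \<notin> X)" for r
  have ex: "\<exists>m. r + m * s \<notin> X" for r
  proof (rule ccontr)
    assume "\<not> ?thesis"
    then have "range (\<lambda>m. r + m * s) \<subseteq> X" by auto
    moreover have "inj (\<lambda>m. r + m * s)" using s by (auto intro: injI)
    ultimately show False using fin finite_subset finite_imageD infinite_UNIV_nat by metis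
  qed
  \<comment> \<open>Closure read backwards: above the first gap of a runner there are only
    gaps.\<close>
  have "r + (n r + i) * s \<notin> X" for r i
  proof (induction i)
    case 0
    show ?case using LeastI_ex[OF ex[of r]] by (simp add: n_def)
  next
    case (Suc i)
    show ?case using Suc closed[of "r + (n r + Suc i) * s"] by (auto simp: algebra_simps)
  qed
  then have "r + m * s \<in> X \<longleftrightarrow> m < n r" for r m
    by (metis le_add_diff_inverse not_less not_less_Least n_def)
  then have "x \<in> X \<longleftrightarrow> x div s < n (x mod s)" for x
    by (metis mod_mult_div_eq mult.commute)
  then show ?thesis by (auto simp: bead_set_def)
qed

section \<open>Attained heights and ranks\<close>

text \<open>A discrete intermediate value theorem. Only rises are limited to 1; drops may be
  arbitrary.\<close>

lemma step_attains:
  fixes g :: "nat \<Rightarrow> nat"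
  assumes "i \<le> j" "\<And>m. Suc m \<le> j \<Longrightarrow> g (Suc m) \<le> g m + 1" "g i \<le> v" "v \<le> g j"
  shows "\<exists>m. m \<le> j \<and> g m = v"
  using assms
proof (induction rule: dec_induct)
  case (step j)
  show ?case
  proof (cases "v = g (Suc j)")
    case False
    then have "v \<le> g j" using step.prems(1)[of j] step.prems(3) by simp
    then show ?thesis using step by (meson le_SucI)
  qed auto
qed auto

text \<open>Ties are broken by index, so that \<open>rank k h\<close> permutes \<open>{..<k}\<close>.\<close>

definition rank :: "nat \<Rightarrow> (nat \<Rightarrow> nat) \<Rightarrow> nat \<Rightarrow> nat" where
  "rank k h j = card {i. i < k \<and> (h i < h j \<or> h i = h j \<and> i < j)}"

lemma rank_less:
  assumes "i < k" "h i < h j \<or> h i = h j \<and> i < j"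
  shows "rank k h i < rank k h j"
  unfolding rank_def by (rule psubset_card_mono) (use assms in auto)

lemma inj_on_rank: "inj_on (rank k h) {..<k}"
proof (rule inj_onI)
  fix i j assume "i \<in> {..<k}" "j \<in> {..<k}" "rank k h i = rank k h j"
  then show "i = j" using rank_less[of i k h j] rank_less[of j k h i] by (cases i j rule: linorder_cases) force+
qed

lemma bij_betw_rank: "bij_betw (rank k h) {..<k} {..<k}"
proof -
  have "rank k h j < k" if "j < k" for j
  proof -
    have "rank k h j < card {..<k}"
      unfolding rank_def by (rule psubset_card_mono) (use that in auto)
    then show ?thesis by simp
  qed
  then have "rank k h ` {..<k} \<subseteq> {..<k}" by auto
  then have "rank k h ` {..<k} = {..<k}"
    by (simp add: card_image card_subset_eq inj_on_rank)
  then show ?thesis using inj_on_rank by (auto simp: bij_betw_def)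
qed

text \<open>Distinct attained values below \<open>h j\<close> come from distinct indices, all of
  which the rank of \<open>j\<close> counts.\<close>

lemma card_attained_le_rank:
  assumes "V \<subseteq> h ` {..<k}" "\<And>v. v \<in> V \<Longrightarrow> v < h j"
  shows "card V \<le> rank k h j"
proof -
  let ?I = "{i. i < k \<and> h i < h j}"
  have "V \<subseteq> h ` ?I" using assms by force
  then have "card V \<le> card ?I"
    by (intro surj_card_le) auto
  also have "\<dots> \<le> rank k h j" unfolding rank_def by (rule card_mono) auto
  finally show ?thesis .
qed

text \<open>The rank of \<open>j\<close> counts everything below \<open>i\<close>, the index
  \<open>i\<close> itself (the summand 1), and an index for each value in \<open>V\<close>.\<close>

lemma card_attained_between_rank:
  assumes "V \<subseteq> h ` {..<k}" "\<And>v. v \<in> V \<Longrightarrow> h i < v \<and> v < h j" "i < k" "h i < h j"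
  shows "rank k h i + card V + 1 \<le> rank k h j"
proof -
  let ?I = "{l. l < k \<and> h i < h l \<and> h l < h j}"
  let ?J = "{l. l < k \<and> (h l < h i \<or> h l = h i \<and> l < i)}"
  have "V \<subseteq> h ` ?I" using assms(1,2) by force
  then have "card V \<le> card ?I"
    by (intro surj_card_le) auto
  moreover have "card (insert i (?J \<union> ?I)) = rank k h i + card ?I + 1"
  proof -
    have "card (?J \<union> ?I) = card ?J + card ?I" by (rule card_Un_disjoint) auto
    moreover have "i \<notin> ?J \<union> ?I" by auto
    ultimately show ?thesis by (simp add: rank_def)
  qed
  moreover have "card (insert i (?J \<union> ?I)) \<le> rank k h j"
    unfolding rank_def by (rule card_mono) (use assms in auto)
  ultimately show ?thesis by linarith
qed

section \<open>The size as a sum over pairs of heights\<close>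

lemma sum_sgn: "j < k \<Longrightarrow> (\<Sum>i<k. sgn (real j - real i)) = 2 * real j - real k + 1"
proof (induction k)
  case (Suc k)
  show ?case
  proof (cases "j = k")
    case True
    have "(\<Sum>i<k. sgn (real k - real i)) = (\<Sum>i<k. 1)" by (rule sum.cong) auto
    then show ?thesis using True by simp
  qed (use Suc in auto)
qed simp

text \<open>This trades the squared total and the position weights for pairwise differences, which
  can be estimated one by one. Summing signs over one index produces the weight
  \<open>2 * real j - real k + 1\<close>.\<close>

lemma double_sum_identity:
  fixes h :: "nat \<Rightarrow> real"
  shows "(\<Sum>i<k. \<Sum>j<k. (h j - h i)^2 + 2 * (sgn (real j - real i) * (h j - h i))) =
    2 * real k * (\<Sum>j<k. (h j)^2) - 2 * (\<Sum>j<k. h j)^2 + 4 * (\<Sum>j<k. h j * (2 * real j - real k + 1))"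
proof -
  have "(\<Sum>i<k. \<Sum>j<k. (h j - h i)^2) =
      (\<Sum>i<k. \<Sum>j<k. (h j)^2) + (\<Sum>i<k. \<Sum>j<k. (h i)^2) - 2 * (\<Sum>i<k. \<Sum>j<k. h i * h j)"
    by (simp add: power2_diff sum.distrib sum_subtractf sum_distrib_left mult_ac)
  also have "(\<Sum>i<k. \<Sum>j<k. h i * h j) = (\<Sum>j<k. h j)^2"
    by (simp add: power2_eq_square sum_product)
  finally have 1: "(\<Sum>i<k. \<Sum>j<k. (h j - h i)^2) = 2 * real k * (\<Sum>j<k. (h j)^2) - 2 * (\<Sum>j<k. h j)^2"
    by (simp add: sum_distrib_left[symmetric])
  have A: "(\<Sum>i<k. \<Sum>j<k. sgn (real j - real i) * h j) = (\<Sum>j<k. h j * (2 * real j - real k + 1))"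
    by (subst sum.swap) (simp add: sum_distrib_right[symmetric] sum_sgn mult.commute[of "h _"])
  have B: "(\<Sum>i<k. \<Sum>j<k. sgn (real j - real i) * h i) = - (\<Sum>j<k. h j * (2 * real j - real k + 1))"
  proof -
    have "(\<Sum>i<k. \<Sum>j<k. sgn (real j - real i) * h i) = (\<Sum>i<k. \<Sum>j<k. - (sgn (real i - real j) * h i))"
      by (intro sum.cong refl) (metis minus_diff_eq minus_mult_left sgn_minus)
    also have "\<dots> = - (\<Sum>j<k. h j * (2 * real j - real k + 1))"
      by (simp add: sum_negf sum_distrib_right[symmetric] sum_sgn mult.commute[of "h _"])
    finally show ?thesis .
  qed
  have "(\<Sum>i<k. \<Sum>j<k. sgn (real j - real i) * (h j - h i)) = 2 * (\<Sum>j<k. h j * (2 * real j - real k + 1))"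
    using A B by (simp add: right_diff_distrib sum_subtractf)
  then show ?thesis using 1 by (simp add: sum.distrib sum_distrib_left[symmetric])
qed

lemma sum_odd_even_split:
  fixes f :: "nat \<Rightarrow> 'a::comm_monoid_add"
  shows "(\<Sum>r<2 * k + 1. f r) = f 0 + (\<Sum>j<k. f (2 * j + 1) + f (2 * j + 2))"
  by (induction k) (auto simp: algebra_simps)

lemma bead_set_size:
  fixes n :: "nat \<Rightarrow> nat" and k :: nat
  defines "s \<equiv> 2 * k + 1"
  defines "X \<equiv> bead_set s n"
  defines "h \<equiv> \<lambda>j. real (n (2 * j + 1) + n (2 * j + 2))"
  assumes n0: "n 0 = 0" and excl: "\<And>j. j < k \<Longrightarrow> n (2 * j + 1) = 0 \<or> n (2 * j + 2) = 0"
  shows "4 * (real (\<Sum>X) - real (card X) * (real (card X) - 1) / 2) =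
    (\<Sum>j<k. 2 * (real k + 1) * (h j)^2 + 4 * real (n (2 * j + 2))) +
    (\<Sum>i<k. \<Sum>j<k. (h j - h i)^2 + 2 * (sgn (real j - real i) * (h j - h i)))"
proof -
  have s: "0 < s" by (simp add: s_def)
  let ?e = "\<lambda>j. real (n (2 * j + 2))"
  have N: "real (card X) = (\<Sum>j<k. h j)"
    unfolding X_def card_bead_set[OF s] unfolding s_def sum_odd_even_split by (simp add: n0 h_def)
  \<comment> \<open>One height of each pair vanishes, so the quadratic terms of the two residues
    merge into one in \<open>h j\<close>.\<close>
  have "4 * real (\<Sum>X) = 4 * (\<Sum>j<k. (2 * real j + 1) * h j + ?e j + real s * (h j * (h j - 1) / 2))"
    unfolding X_def sum_bead_set[OF s] unfolding s_def sum_odd_even_split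
    by (simp only: n0) (auto intro!: sum.cong dest!: excl simp: h_def field_simps)
  also have "\<dots> = 4 * (\<Sum>j<k. ?e j) + (4 * real k + 2) * (\<Sum>j<k. (h j)^2)
      + 4 * (\<Sum>j<k. h j * (2 * real j - real k + 1)) - 2 * (\<Sum>j<k. h j)"
    unfolding sum_distrib_left sum.distrib[symmetric] sum_subtractf[symmetric]
    by (intro sum.cong refl) (simp add: s_def power2_eq_square field_simps)
  finally have S: "4 * real (\<Sum>X) = \<dots>" .
  have E: "(\<Sum>j<k. 2 * (real k + 1) * (h j)^2 + 4 * ?e j) =
      2 * (real k + 1) * (\<Sum>j<k. (h j)^2) + 4 * (\<Sum>j<k. ?e j)"
    by (simp add: sum.distrib sum_distrib_left)
  define P Q R T where "P = (\<Sum>j<k. h j)" and "Q = (\<Sum>j<k. (h j)^2)"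
    and "R = (\<Sum>j<k. h j * (2 * real j - real k + 1))" and "T = (\<Sum>j<k. ?e j)"
  have "4 * real (\<Sum>X) = 4 * T + (4 * real k + 2) * Q + 4 * R - 2 * P"
    using S by (simp only: P_def Q_def R_def T_def)
  \<comment> \<open>The linear terms in \<open>P\<close> cancel, and
    \<open>(4 * real k + 2) * Q\<close> splits so that \<open>2 * real k * Q\<close> goes to the
    double sum.\<close>
  then have "4 * (real (\<Sum>X) - P * (P - 1) / 2) =
      2 * (real k + 1) * Q + 4 * T + (2 * real k * Q - 2 * P^2 + 4 * R)"
    by (simp add: power2_eq_square field_simps)
  then show ?thesis
    unfolding double_sum_identity E N by (simp only: P_def Q_def R_def T_def)
qed

section \<open>Bounding the sum by that of a permutation\<close>

lemma card_Diff_singleton_ge: "card A - 1 \<le> card (A - {x})"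
  using diff_card_le_card_Diff[of "{x}" A] by simp

text \<open>Here \<open>o' j\<close> and \<open>e j\<close> stand for the heights at residues
  \<open>2 * j + 1\<close> and \<open>2 * j + 2\<close>. The bound on \<open>e 0\<close> reflects
  the empty residue 0, and the one on \<open>o' 0\<close> the step from residue \<open>2 * k\<close>
  to 1.\<close>

lemma height_bound:
  fixes o' e :: "nat \<Rightarrow> nat" and k :: nat
  defines "h \<equiv> \<lambda>j. o' j + e j"
  assumes excl: "\<And>j. j < k \<Longrightarrow> o' j = 0 \<or> e j = 0"
    and e0: "e 0 \<le> 1" and eS: "\<And>j. Suc j < k \<Longrightarrow> e (Suc j) \<le> e j + 1"
    and o0: "o' 0 \<le> e (k - 1) + 2" and oS: "\<And>j. Suc j < k \<Longrightarrow> o' (Suc j) \<le> o' j + 1"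
  shows "(\<Sum>j<k. 2 * (real k + 1) * (real (h j))^2 + 4 * real (e j)) +
    (\<Sum>i<k. \<Sum>j<k. (real (h j) - real (h i))^2 +
       2 * (sgn (real j - real i) * (real (h j) - real (h i))))
    \<le> (\<Sum>a<k. 2 * (real k + 1) * (real a + 2)^2) +
      (\<Sum>a<k. \<Sum>b<k. (real b - real a)^2 + 2 * \<bar>real b - real a\<bar>)"
proof -
  \<comment> \<open>Positivity of \<open>v\<close> matters: \<open>o' m = v\<close> then forces
    \<open>e m = 0\<close>, so that \<open>h m = v\<close>.\<close>
  have o_att: "v \<in> h ` {..<k}" if a: "j < k" "i \<le> j" "o' i \<le> v" "0 < v" "v \<le> o' j" for i j v
  proof -
    have step: "o' (Suc m) \<le> o' m + 1" if "Suc m \<le> j" for m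
      using oS[of m] \<open>j < k\<close> that by simp
    obtain m where m: "m \<le> j" "o' m = v"
      using step_attains[OF a(2) step a(3) a(5)] by blast
    then have "h m = v" "m < k" using a m excl[of m] by (auto simp: h_def)
    then show ?thesis by blast
  qed
  have e_att: "v \<in> h ` {..<k}" if a: "j < k" "i \<le> j" "e i \<le> v" "0 < v" "v \<le> e j" for i j v
  proof -
    have step: "e (Suc m) \<le> e m + 1" if "Suc m \<le> j" for m
      using eS[of m] \<open>j < k\<close> that by simp
    obtain m where m: "m \<le> j" "e m = v"
      using step_attains[OF a(2) step a(3) a(5)] by blast
    then have "h m = v" "m < k" using a m excl[of m] by (auto simp: h_def)
    then show ?thesis by blast
  qed
  \<comment> \<open>No height is skipped along the even residues. The gain of one over
    \<open>o_rank\<close> pays for the term \<open>4 * real (e j)\<close> in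
    \<open>single\<close>.\<close>
  have e_rank: "e j \<le> rank k h j + 1" if j: "j < k" "0 < e j" for j
  proof -
    have "{1..<e j} \<subseteq> h ` {..<k}" using e_att[of j 0] j e0 by auto
    then have "card {1..<e j} \<le> rank k h j"
      by (rule card_attained_le_rank) (auto simp: h_def)
    then show ?thesis by simp
  qed
  have o_rank: "o' j \<le> rank k h j + 2" if j: "j < k" for j
  proof -
    \<comment> \<open>\<open>e (k - 1) + 1\<close> is the only height that can be skipped, when \<open>o' 0 = e (k - 1) + 2\<close>.\<close>
    have "v \<in> h ` {..<k}" if v: "v \<in> {1..<o' j} - {e (k - 1) + 1}" for v
    proof (cases "o' 0 \<le> v")
      case True
      then show ?thesis using o_att[of j 0 v] j v by auto
    next
      case False
      then show ?thesis using e_att[of "k - 1" 0 v] j v o0 e0 by auto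
    qed
    then have "{1..<o' j} - {e (k - 1) + 1} \<subseteq> h ` {..<k}" by blast
    then have "card ({1..<o' j} - {e (k - 1) + 1}) \<le> rank k h j"
      by (rule card_attained_le_rank) (auto simp: h_def)
    moreover have "card {1..<o' j} - 1 \<le> card ({1..<o' j} - {e (k - 1) + 1})"
      by (rule card_Diff_singleton_ge)
    ultimately show ?thesis by simp
  qed
  \<comment> \<open>Whichever of \<open>o'\<close> and \<open>e\<close> carries the height at
    \<open>j\<close> is at most \<open>h i\<close> at \<open>i\<close>, so the climb stays in one
    family and skips nothing.\<close>
  have up: "h j + rank k h i \<le> rank k h j + h i" if ij: "i < j" "j < k" "h i < h j" for i j
  proof -
    have "v \<in> h ` {..<k}" if v: "h i < v" "v < h j" for v
      using o_att[of j i v] e_att[of j i v] ij v excl[of i] excl[of j] by (auto simp: h_def)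
    then have "{h i<..<h j} \<subseteq> h ` {..<k}" by auto
    then have "rank k h i + card {h i<..<h j} + 1 \<le> rank k h j"
      by (rule card_attained_between_rank) (use ij in auto)
    then show ?thesis using ij by simp
  qed
  \<comment> \<open>The climb to \<open>i\<close> may now have to pass from \<open>e (k - 1)\<close>
    to \<open>o' 0\<close>, where one height can be lost; hence the extra 1.\<close>
  have down: "h i + rank k h j \<le> rank k h i + h j + 1" if ij: "i < j" "j < k" "h j < h i" for i j
  proof -
    have "v \<in> h ` {..<k}" if v: "v \<in> {h j<..<h i} - {e (k - 1) + 1}" for v
    proof (cases "e i = 0")
      case True
      show ?thesis
      proof (cases "o' 0 \<le> v")
        case o: True
        then show ?thesis using o_att[of i 0 v] ij v True by (auto simp: h_def)
      next
        case False
        then show ?thesis using e_att[of "k - 1" j v] ij v o0 by (auto simp: h_def)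
      qed
    next
      case False
      then show ?thesis using e_att[of i 0 v] ij v e0 excl[of i] by (auto simp: h_def)
    qed
    then have "{h j<..<h i} - {e (k - 1) + 1} \<subseteq> h ` {..<k}" by blast
    then have "rank k h j + card ({h j<..<h i} - {e (k - 1) + 1}) + 1 \<le> rank k h i"
      by (rule card_attained_between_rank) (use ij in auto)
    moreover have "card {h j<..<h i} - 1 \<le> card ({h j<..<h i} - {e (k - 1) + 1})"
      by (rule card_Diff_singleton_ge)
    ultimately show ?thesis using ij by simp
  qed
  define \<rho> where "\<rho> = rank k h"
  have bij: "bij_betw \<rho> {..<k} {..<k}" unfolding \<rho>_def by (rule bij_betw_rank)
  have single: "2 * (real k + 1) * (real (h j))^2 + 4 * real (e j) \<le> 2 * (real k + 1) * (real (\<rho> j) + 2)^2"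
    if j: "j < k" for j
  proof (cases "e j = 0")
    case True
    then have "real (h j) \<le> real (\<rho> j) + 2" using o_rank[OF j] by (simp add: h_def \<rho>_def)
    then show ?thesis using True by (auto intro!: mult_left_mono power_mono)
  next
    case False
    then have he: "h j = e j" "1 \<le> e j" using excl[OF j] by (auto simp: h_def)
    have "real (e j) + 1 \<le> real (\<rho> j) + 2" using e_rank[OF j] False by (simp add: \<rho>_def)
    then have "2 * (real k + 1) * (real (e j) + 1)^2 \<le> 2 * (real k + 1) * (real (\<rho> j) + 2)^2"
      by (intro mult_left_mono power_mono) auto
    moreover have "0 \<le> real k * real (e j)" by simp
    then have "2 * (real k + 1) * (real (e j))^2 + 4 * real (e j) \<le> 2 * (real k + 1) * (real (e j) + 1)^2"
      by (simp add: power2_eq_square algebra_simps)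
    ultimately show ?thesis unfolding he(1) by linarith
  qed
  \<comment> \<open>Both sides become squares after adding 1. For negative \<open>x\<close> the
    shift in \<open>x + 1\<close> absorbs the height lost in \<open>down\<close>.\<close>
  have sq: "x^2 + 2 * x \<le> y^2 + 2 * \<bar>y\<bar>" if "\<bar>x + 1\<bar> \<le> \<bar>y\<bar> + 1" for x y :: real
  proof -
    have "\<bar>x + 1\<bar>^2 \<le> (\<bar>y\<bar> + 1)^2" using that by (intro power_mono) auto
    then show ?thesis by (simp add: power2_eq_square algebra_simps)
  qed
  have pair: "(real (h j) - real (h i))^2 + 2 * (real (h j) - real (h i))
      \<le> (real (\<rho> j) - real (\<rho> i))^2 + 2 * \<bar>real (\<rho> j) - real (\<rho> i)\<bar>"
    if ij: "i < j" "j < k" for i j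
  proof (rule sq, cases "h i \<le> h j")
    case True
    then have "real (h j) - real (h i) \<le> \<bar>real (\<rho> j) - real (\<rho> i)\<bar>"
      using up[OF ij] by (cases "h i = h j") (auto simp: \<rho>_def)
    then show "\<bar>real (h j) - real (h i) + 1\<bar> \<le> \<bar>real (\<rho> j) - real (\<rho> i)\<bar> + 1"
      using True by simp
  next
    case False
    then show "\<bar>real (h j) - real (h i) + 1\<bar> \<le> \<bar>real (\<rho> j) - real (\<rho> i)\<bar> + 1"
      using down[OF ij] by (simp add: \<rho>_def)
  qed
  \<comment> \<open>Swapping \<open>i\<close> and \<open>j\<close> flips both the sign factor and
    the difference, so the case \<open>i < j\<close> suffices off the diagonal.\<close>
  have pair': "(real (h j) - real (h i))^2 + 2 * (sgn (real j - real i) * (real (h j) - real (h i)))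
      \<le> (real (\<rho> j) - real (\<rho> i))^2 + 2 * \<bar>real (\<rho> j) - real (\<rho> i)\<bar>"
    if "i < k" "j < k" for i j
    using pair[of i j] pair[of j i] that
    by (cases i j rule: linorder_cases) (auto simp: power2_commute abs_minus_commute)
  have "(\<Sum>j<k. 2 * (real k + 1) * (real (h j))^2 + 4 * real (e j))
      \<le> (\<Sum>j<k. 2 * (real k + 1) * (real (\<rho> j) + 2)^2)"
    by (intro sum_mono single) auto
  also have "\<dots> = (\<Sum>a<k. 2 * (real k + 1) * (real a + 2)^2)"
    by (rule sum.reindex_bij_betw[OF bij])
  finally have 1: "(\<Sum>j<k. 2 * (real k + 1) * (real (h j))^2 + 4 * real (e j)) \<le> \<dots>" .
  have "(\<Sum>i<k. \<Sum>j<k. (real (h j) - real (h i))^2 +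
       2 * (sgn (real j - real i) * (real (h j) - real (h i))))
    \<le> (\<Sum>i<k. \<Sum>j<k. (real (\<rho> j) - real (\<rho> i))^2 + 2 * \<bar>real (\<rho> j) - real (\<rho> i)\<bar>)"
    by (intro sum_mono pair') auto
  also have "\<dots> = (\<Sum>i<k. \<Sum>b<k. (real b - real (\<rho> i))^2 + 2 * \<bar>real b - real (\<rho> i)\<bar>)"
    by (intro sum.cong refl sum.reindex_bij_betw[OF bij])
  also have "\<dots> = (\<Sum>a<k. \<Sum>b<k. (real b - real a)^2 + 2 * \<bar>real b - real a\<bar>)"
    by (rule sum.reindex_bij_betw[OF bij])
  finally show ?thesis using 1 by linarith
qed

section \<open>Evaluation of the extremal sum\<close>

lemma max_size_sum:
  "(\<Sum>a<k. 2 * (real k + 1) * (real a + 2)^2) +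
      (\<Sum>a<k. \<Sum>b<k. (real b - real a)^2 + 2 * \<bar>real b - real a\<bar>)
   = real k * (real k + 1) * (real k + 2) * (5 * real k + 11) / 6"
proof -
  have 1: "(\<Sum>a<k. c * (real a + 2)^2) = c * real k * (2 * real k^2 + 9 * real k + 13) / 6" for c
    by (induction k) (auto simp: power2_eq_square field_simps)
  \<comment> \<open>Keeping \<open>x\<close> separate from \<open>m\<close> lets the induction run;
    it is used with both equal to \<open>k\<close>, for the last row and column of the
    square.\<close>
  have row: "(\<Sum>a<m. (x - real a)^2 + 2 * (x - real a)) =
      real m * (x^2 + 2 * x) - (x + 1) * real m * (real m - 1) + real m * (real m - 1) * (2 * real m - 1) / 6"
    for x m by (induction m) (auto simp: power2_eq_square field_simps)
  have 2: "(\<Sum>a<k. \<Sum>b<k. (real b - real a)^2 + 2 * \<bar>real b - real a\<bar>)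
      = real k * (real k^2 - 1) * (real k + 4) / 6"
  proof (induction k)
    case (Suc k)
    have r: "(\<Sum>a<k. (real k - real a)^2 + 2 * \<bar>real k - real a\<bar>) =
        (\<Sum>a<k. (real k - real a)^2 + 2 * (real k - real a))"
      by (rule sum.cong) auto
    have c: "(\<Sum>a<k. (real a - real k)^2 + 2 * \<bar>real a - real k\<bar>) =
        (\<Sum>a<k. (real k - real a)^2 + 2 * (real k - real a))"
      by (rule sum.cong) (auto simp: power2_commute)
    have split: "(\<Sum>a<Suc k. \<Sum>b<Suc k. f a b) =
        (\<Sum>a<k. \<Sum>b<k. f a b) + (\<Sum>a<k. f a k) + (\<Sum>b<k. f k b) + f k k"
      for f :: "nat \<Rightarrow> nat \<Rightarrow> real"
      by (simp add: sum.distrib)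
    show ?case
      unfolding split Suc r c row by (simp add: power2_eq_square field_simps)
  qed simp
  show ?thesis unfolding 1 2 by (simp add: power2_eq_square field_simps)
qed

section \<open>The upper bound and the extremal core\<close>

lemma core_partition_size_le:
  assumes "p \<in> distinct_core_partitions (2 * k + 1) (2 * k + 3)"
  shows "4 * real (partition_size p) \<le> real k * (real k + 1) * (real k + 2) * (5 * real k + 11) / 6"
proof -
  define s where "s = 2 * k + 1"
  define X where "X = beta_set p"
  have s: "0 < s" "2 * k + 3 = s + 2" by (simp_all add: s_def)
  have p: "is_partition p" "distinct p" "is_core s p" "is_core (s + 2) p"
    using assms by (auto simp: distinct_core_partitions_def s_def numeral_3_eq_3)
  have closed_s: "x - s \<in> X" if "x \<in> X" "s \<le> x" for x
    using is_core_iff_closed[OF p(1) s(1)] p(3) that by (simp add: X_def)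
  have closed_t: "x - (s + 2) \<in> X" if "x \<in> X" "s + 2 \<le> x" for x
    using is_core_iff_closed[OF p(1), of "s + 2"] p(4) that by (simp add: X_def)
  obtain n where n: "X = bead_set s n"
    using closed_eq_bead_set[of X s] closed_s s(1) by (auto simp: X_def)
  have mem: "r + m * s \<in> X \<longleftrightarrow> m < n r" if "r < s" for r m
    using that by (simp add: n bead_set_def)
  have "0 \<notin> X" using zero_notin_beta_set[OF p(1)] by (simp add: X_def)
  then have n0: "n 0 = 0" using mem[of 0 0] s by simp
  have excl: "n r = 0 \<or> n (Suc r) = 0" if "Suc r < s" for r
    using mem[of r 0] mem[of "Suc r" 0] that no_consecutive_beta_set[OF p(1,2), of r]
    by (auto simp: X_def)
  \<comment> \<open>Otherwise subtracting \<open>s + 2\<close> from the bead in position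
    \<open>n r + 1\<close> of runner \<open>r + 2\<close> would land on the first gap of runner
    \<open>r\<close>.\<close>
  have step: "n (r + 2) \<le> n r + 1" if r: "r + 2 < s" for r
  proof (rule ccontr)
    assume "\<not> ?thesis"
    then have "(r + 2) + (n r + 1) * s \<in> X" using mem[of "r + 2" "n r + 1"] r by simp
    then have "r + n r * s \<in> X" using closed_t[of "(r + 2) + (n r + 1) * s"] by simp
    then show False using mem[of r "n r"] r by simp
  qed
  \<comment> \<open>From residue 1, subtracting 2 borrows a further \<open>s\<close>: the bead moves
    two positions down, to runner \<open>s - 1\<close>.\<close>
  have wrap: "n 1 \<le> n (s - 1) + 2" if "1 < s"
  proof (rule ccontr)
    assume "\<not> ?thesis"
    then have "1 + (n (s - 1) + 2) * s \<in> X" using mem[of 1 "n (s - 1) + 2"] that by simp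
    moreover have "s + 2 \<le> 1 + (n (s - 1) + 2) * s" using that by simp
    moreover have "1 + (n (s - 1) + 2) * s - (s + 2) = (s - 1) + n (s - 1) * s"
      using that by simp
    ultimately have "(s - 1) + n (s - 1) * s \<in> X" using closed_t by metis
    then show False using mem[of "s - 1" "n (s - 1)"] s by simp
  qed
  have size: "4 * real (partition_size p) =
      4 * (real (\<Sum>X) - real (card X) * (real (card X) - 1) / 2)"
    using partition_size_eq[OF p(1)] by (simp add: X_def)
  show ?thesis
  \<comment> \<open>For \<open>k = 0\<close> the only residue is 0, so \<open>X\<close> is empty,
    and there is no last index \<open>k - 1\<close>.\<close>
  proof (cases "k = 0")
    case True
    then have "n (x mod s) = 0" for x using n0 by (simp add: s_def)
    then have "X = {}" by (simp add: n bead_set_def)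
    then show ?thesis using size True by simp
  next
    case False
    have pair: "n (2 * j + 1) = 0 \<or> n (2 * j + 2) = 0" if "j < k" for j
      using excl[of "2 * j + 1"] that by (simp add: s_def)
    have "4 * real (partition_size p) =
        (\<Sum>j<k. 2 * (real k + 1) * (real (n (2 * j + 1) + n (2 * j + 2)))^2 + 4 * real (n (2 * j + 2))) +
        (\<Sum>i<k. \<Sum>j<k.
          (real (n (2 * j + 1) + n (2 * j + 2)) - real (n (2 * i + 1) + n (2 * i + 2)))^2 +
          2 * (sgn (real j - real i) *
            (real (n (2 * j + 1) + n (2 * j + 2)) - real (n (2 * i + 1) + n (2 * i + 2)))))"
      unfolding size n s_def using bead_set_size[of n k, OF n0 pair] by blast
    also have "\<dots> \<le> (\<Sum>a<k. 2 * (real k + 1) * (real a + 2)^2) +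
        (\<Sum>a<k. \<Sum>b<k. (real b - real a)^2 + 2 * \<bar>real b - real a\<bar>)"
    proof (rule height_bound)
      show "n (2 * 0 + 2) \<le> 1" using step[of 0] n0 False by (simp add: s_def)
      show "n (2 * Suc j + 2) \<le> n (2 * j + 2) + 1" if "Suc j < k" for j
        using step[of "2 * j + 2"] that by (simp add: s_def)
      show "n (2 * Suc j + 1) \<le> n (2 * j + 1) + 1" if "Suc j < k" for j
        using step[of "2 * j + 1"] that by (simp add: s_def)
      have "2 * (k - 1) + 2 = s - 1" using False by (simp add: s_def)
      then show "n (2 * 0 + 1) \<le> n (2 * (k - 1) + 2) + 2"
        using wrap False by (simp add: s_def)
    qed (rule pair)
    finally show ?thesis unfolding max_size_sum .
  qed
qed

text \<open>The heights \<open>j + 2\<close> on odd residues take every allowed rise in full, and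
  they increase with the index, so each sign term is an absolute value.\<close>

lemma ex_core_partition_size_eq:
  "\<exists>p\<in>distinct_core_partitions (2 * k + 1) (2 * k + 3).
     4 * real (partition_size p) = real k * (real k + 1) * (real k + 2) * (5 * real k + 11) / 6"
proof -
  define s where "s = 2 * k + 1"
  define n :: "nat \<Rightarrow> nat" where "n r = (if odd r then (r + 3) div 2 else 0)" for r
  define Y where "Y = bead_set s n"
  have s: "0 < s" by (simp add: s_def)
  have n_odd: "n (2 * j + 1) = j + 2" and n_even: "n (2 * j + 2) = 0" for j
    by (simp_all add: n_def)
  have mem: "r + m * s \<in> Y \<longleftrightarrow> m < n r" if "r < s" for r m
    using that by (simp add: Y_def bead_set_def)
  have elem: "\<exists>j m. j < k \<and> m < j + 2 \<and> x = 2 * j + 1 + m * s" if x: "x \<in> Y" for x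
  proof -
    have "x div s < n (x mod s)" using x by (simp add: Y_def bead_set_def)
    moreover from this have "odd (x mod s)" by (auto simp: n_def split: if_splits)
    then obtain j where j: "x mod s = 2 * j + 1" by (elim oddE)
    moreover have "2 * j + 1 < s" using mod_less_divisor[OF s, of x] unfolding j .
    then have "j < k" by (simp add: s_def)
    moreover have "x = x mod s + x div s * s" by simp
    ultimately show ?thesis using n_odd by metis
  qed
  have Suc: "Suc x \<notin> Y" if x: "x \<in> Y" for x
  proof -
    obtain j m where jm: "j < k" "x = 2 * j + 1 + m * s" using elem[OF x] by blast
    have "Suc x = (2 * j + 2) + m * s" using jm by simp
    moreover have "\<not> (2 * j + 2) + m * s \<in> Y"
      using mem[of "2 * j + 2" m] jm(1) n_even[of j] by (simp add: s_def)
    ultimately show ?thesis by metis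
  qed
  have "0 \<notin> Y" using mem[of 0 0] s by (simp add: n_def)
  then obtain p where p: "is_partition p" "distinct p" "beta_set p = Y"
    using ex_partition_beta_set[of Y] Suc finite_bead_set[OF s] by (auto simp: Y_def)
  have "x - s \<in> Y" if x: "x \<in> Y" "s \<le> x" for x
  proof -
    obtain j m where jm: "j < k" "m < j + 2" "x = 2 * j + 1 + m * s" using elem[OF x(1)] by blast
    then obtain m' where m': "m = Suc m'" using x(2) by (cases m) (auto simp: s_def)
    then have "x - s = 2 * j + 1 + m' * s" using jm by simp
    then show ?thesis using mem[of "2 * j + 1" m'] jm m' n_odd[of j] by (simp add: s_def)
  qed
  then have "is_core s p" using is_core_iff_closed[OF p(1) s] p(3) by simp
  moreover have "x - (s + 2) \<in> Y" if x: "x \<in> Y" "s + 2 \<le> x" for x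
  proof -
    obtain j m where jm: "j < k" "m < j + 2" "x = 2 * j + 1 + m * s" using elem[OF x(1)] by blast
    then obtain m' where m': "m = Suc m'" using x(2) by (cases m) (auto simp: s_def)
    \<comment> \<open>Runner 1 holds only 1 and \<open>s + 1\<close>, both too small to subtract
      \<open>s + 2\<close>.\<close>
    have "j \<noteq> 0"
    proof
      assume "j = 0"
      then have "x \<le> s + 1" using jm m' by simp
      then show False using x(2) by simp
    qed
    then obtain j' where j': "j = Suc j'" by (cases j) auto
    have "x - (s + 2) = 2 * j' + 1 + m' * s" using jm m' j' by simp
    then show ?thesis using mem[of "2 * j' + 1" m'] jm m' j' n_odd[of j'] by (simp add: s_def)
  qed
  then have "is_core (s + 2) p" using is_core_iff_closed[OF p(1), of "s + 2"] p(3) by simp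
  ultimately have "p \<in> distinct_core_partitions (2 * k + 1) (2 * k + 3)"
    using p by (simp add: distinct_core_partitions_def s_def numeral_3_eq_3)
  moreover have "4 * real (partition_size p) =
      (\<Sum>j<k. 2 * (real k + 1) * (real j + 2)^2) +
      (\<Sum>i<k. \<Sum>j<k. (real j - real i)^2 + 2 * \<bar>real j - real i\<bar>)"
  proof -
    have "sgn (real j - real i) * (real j - real i) = \<bar>real j - real i\<bar>" for i j
      by (simp add: abs_sgn mult.commute)
    moreover have "real (n (2 * j + 1) + n (2 * j + 2)) = real j + 2" for j
      unfolding n_odd n_even by simp
    moreover have "n 0 = 0" by (simp add: n_def)
    ultimately show ?thesis
      using bead_set_size[of n k] n_even partition_size_eq[OF p(1)]
      unfolding p(3) Y_def s_def by simp
  qed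
  ultimately show ?thesis unfolding max_size_sum by blast
qed

theorem theorem7:
  fixes k :: nat
  defines "sizes \<equiv> partition_size ` distinct_core_partitions (2 * k + 1) (2 * k + 3)"
  shows "finite sizes \<and> sizes \<noteq> {} \<and>
         real (Max sizes) = real k * (real k + 1) * (real k + 2) * (5 * real k + 11) / 24"
proof -
  obtain p where p: "p \<in> distinct_core_partitions (2 * k + 1) (2 * k + 3)"
    "4 * real (partition_size p) = real k * (real k + 1) * (real k + 2) * (5 * real k + 11) / 6"
    using ex_core_partition_size_eq by blast
  have le: "x \<le> partition_size p" if "x \<in> sizes" for x
    using that core_partition_size_le[of _ k] p(2) unfolding sizes_def by fastforce
  have mem: "partition_size p \<in> sizes" using p(1) by (simp add: sizes_def)
  have fin: "finite sizes" using le by (meson finite_nat_set_iff_bounded_le)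
  have "Max sizes = partition_size p" using fin mem le by (intro Max_eqI)
  then show ?thesis using fin mem p(2) by auto
qed

end
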